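(* Let $(V,b,m)$ be an infinite, locally finite, connected graph over a non-Archimedean ordered field $\mathbb K$ which is Cauchy complete and has countable cofinality. If the effective capacity $\mathrm{cap}(a)=\lim_{n\to\infty}\mathrm{cap}_n(a)$ exists in $\mathbb K$ for some $a\in V$, then $\mathrm{cap}(x)$ exists for all $x\in V$. Moreover, if $\mathrm{cap}(a)=0$ for some $a\in V$, then $\mathrm{cap}(x)=0$ for all $x\in V$.
   Context: An ordered field $(\mathbb K,\succ)$ is non-Archimedean if there is $\tau\succ0$ with $\tau\prec 1/n$ for all $n\in\mathbb N$. $\mathbb K^+=\{k\in\mathbb K: k\succ0\}$. A sequence $(k_n)$ converges to $k\in\mathbb K$ if for every $c\in\mathbb K^+$ one has $|k_n-k|\preceq c$ for all large $n$. Cauchy complete: every Cauchy sequence converges. Countable cofinality: there is a countable $S\subset\mathbb K$ such that every $k\in\mathbb K$ satisfies $k\preceq s$ for some $s\in S$. A graph $(V,b,m)$ over $\mathbb K$: $V$ is an at most countable set, $m:V\to\mathbb K^+$, and $b:V\times V\to\mathbb K^+\cup\{0\}$ is symmetric with $b(x,x)=0$. Write $x\sim y$ if $b(x,y)\neq0$; locally finite means each vertex has finitely many neighbors; connectedness is with respect to paths $x_0\sim x_1\sim\dots\sim x_n$, and $d$ is the combinatorial graph distance. $B_n(a)=\{x\in V: d(a,x)<n\}$. Laplacian: $\Delta f(x)=\frac1{m(x)}\sum_{y\in V}(f(x)-f(y))b(x,y)$ for $f:V\to\mathbb K$. For a finite connected $K\subseteq V$ and $a\in K$ there is a unique $v:V\to\mathbb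 K$ with $\Delta v=0$ on $K\setminus\{a\}$, $v(a)=1$, $v=0$ on $V\setminus K$; put $\mathrm{cap}_K(a)=\Delta v(a)m(a)$ and $\mathrm{cap}_n(a)=\mathrm{cap}_{B_n(a)}(a)$, $n\ge1$. The effective capacity is $\mathrm{cap}(a)=\lim_{n\to\infty}\mathrm{cap}_n(a)$ if this limit exists in $\mathbb K$. *)

theory Defs
  imports Main "HOL-Library.Countable_Set" "HOL-Library.FuncSet"
begin

section \<open>Ordered fields\<close>

definition non_archimedean :: "'k::linordered_field itself \<Rightarrow> bool" where
  "non_archimedean _ \<longleftrightarrow> (\<exists>\<tau>::'k. 0 < \<tau> \<and> (\<forall>n::nat. 1 \<le> n \<longrightarrow> \<tau> < 1 / of_nat n))"

text \<open>The tolerance \<open>c\<close> ranges over the positive elements of the field itself, not over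
  rationals or reals; the type class carries no topology, so convergence is spelled out.\<close>

definition converges_to :: "(nat \<Rightarrow> 'k::linordered_field) \<Rightarrow> 'k \<Rightarrow> bool" where
  "converges_to s k \<longleftrightarrow> (\<forall>c>0. \<exists>N. \<forall>n\<ge>N. \<bar>s n - k\<bar> \<le> c)"

definition cauchy_seq :: "(nat \<Rightarrow> 'k::linordered_field) \<Rightarrow> bool" where
  "cauchy_seq s \<longleftrightarrow> (\<forall>c>0. \<exists>N. \<forall>i\<ge>N. \<forall>j\<ge>N. \<bar>s i - s j\<bar> \<le> c)"

definition cauchy_complete :: "'k::linordered_field itself \<Rightarrow> bool" where
  "cauchy_complete _ \<longleftrightarrow> (\<forall>s::nat \<Rightarrow> 'k. cauchy_seq s \<longrightarrow> (\<exists>k. converges_to s k))"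

definition countable_cofinality :: "'k::linordered_field itself \<Rightarrow> bool" where
  "countable_cofinality _ \<longleftrightarrow> (\<exists>S::'k set. countable S \<and> (\<forall>k. \<exists>s\<in>S. k \<le> s))"

section \<open>Weighted graphs over an ordered field\<close>

text \<open>The vertex set is an explicit carrier \<open>V\<close>; values of \<open>b\<close> and \<open>m\<close> off \<open>V\<close> are
  unconstrained and never used.\<close>

locale weighted_graph =
  fixes V :: "'v set" and b :: "'v \<Rightarrow> 'v \<Rightarrow> 'k::linordered_field" and m :: "'v \<Rightarrow> 'k"
  assumes countable_V: "countable V"
    and m_pos: "x \<in> V \<Longrightarrow> 0 < m x"
    and b_nonneg: "x \<in> V \<Longrightarrow> y \<in> V \<Longrightarrow> 0 \<le> b x y"
    and b_sym: "x \<in> V \<Longrightarrow> y \<in> V \<Longrightarrow> b x y = b y x"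
    and b_diag: "x \<in> V \<Longrightarrow> b x x = 0"

definition adj :: "'v set \<Rightarrow> ('v \<Rightarrow> 'v \<Rightarrow> 'k::linordered_field) \<Rightarrow> 'v \<Rightarrow> 'v \<Rightarrow> bool" where
  "adj V b x y \<longleftrightarrow> x \<in> V \<and> y \<in> V \<and> b x y \<noteq> 0"

definition locally_finite_graph :: "'v set \<Rightarrow> ('v \<Rightarrow> 'v \<Rightarrow> 'k::linordered_field) \<Rightarrow> bool" where
  "locally_finite_graph V b \<longleftrightarrow> (\<forall>x\<in>V. finite {y. adj V b x y})"

text \<open>\<open>(adj V b ^^ n) x y\<close> says that there is a path
  \<open>x = x\<^sub>0 \<sim> x\<^sub>1 \<sim> \<dots> \<sim> x\<^sub>n = y\<close> (\<open>relpowp_fun_conv\<close>).\<close>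

definition connected_graph :: "'v set \<Rightarrow> ('v \<Rightarrow> 'v \<Rightarrow> 'k::linordered_field) \<Rightarrow> bool" where
  "connected_graph V b \<longleftrightarrow> (\<forall>x\<in>V. \<forall>y\<in>V. \<exists>n. (adj V b ^^ n) x y)"

text \<open>Meaningful only if \<open>x\<close> and \<open>y\<close> are joined by a path, as in a connected graph.\<close>

definition graph_dist :: "'v set \<Rightarrow> ('v \<Rightarrow> 'v \<Rightarrow> 'k::linordered_field) \<Rightarrow> 'v \<Rightarrow> 'v \<Rightarrow> nat" where
  "graph_dist V b x y = (LEAST n. (adj V b ^^ n) x y)"

definition graph_ball :: "'v set \<Rightarrow> ('v \<Rightarrow> 'v \<Rightarrow> 'k::linordered_field) \<Rightarrow> nat \<Rightarrow> 'v \<Rightarrow> 'v set" where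
  "graph_ball V b n a = {x \<in> V. graph_dist V b a x < n}"

text \<open>The sum over all of \<open>V\<close> is restricted to the neighbours of \<open>x\<close>, where its nonzero terms
  live: a \<open>sum\<close> over an infinite set would be \<open>0\<close> by convention.\<close>

definition laplacian ::
  "'v set \<Rightarrow> ('v \<Rightarrow> 'v \<Rightarrow> 'k::linordered_field) \<Rightarrow> ('v \<Rightarrow> 'k) \<Rightarrow> ('v \<Rightarrow> 'k) \<Rightarrow> 'v \<Rightarrow> 'k" where
  "laplacian V b m f x = 1 / m x * (\<Sum>y | adj V b x y. (f x - f y) * b x y)"

section \<open>Capacity\<close>

text \<open>Functions \<open>V \<rightarrow> \<K>\<close> are taken to be \<open>extensional\<close>, so that uniqueness of the solution
  (for finite connected \<open>K\<close>) is literally uniqueness as required by \<open>THE\<close>.\<close>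

definition capacity_potential ::
  "'v set \<Rightarrow> ('v \<Rightarrow> 'v \<Rightarrow> 'k::linordered_field) \<Rightarrow> ('v \<Rightarrow> 'k) \<Rightarrow> 'v set \<Rightarrow> 'v \<Rightarrow> 'v \<Rightarrow> 'k" where
  "capacity_potential V b m K a = (THE v. v \<in> extensional V \<and>
     (\<forall>x\<in>K - {a}. laplacian V b m v x = 0) \<and> v a = 1 \<and> (\<forall>x\<in>V - K. v x = 0))"

definition capacity_on ::
  "'v set \<Rightarrow> ('v \<Rightarrow> 'v \<Rightarrow> 'k::linordered_field) \<Rightarrow> ('v \<Rightarrow> 'k) \<Rightarrow> 'v set \<Rightarrow> 'v \<Rightarrow> 'k" where
  "capacity_on V b m K a = laplacian V b m (capacity_potential V b m K a) a * m a"

definition ball_capacity ::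
  "'v set \<Rightarrow> ('v \<Rightarrow> 'v \<Rightarrow> 'k::linordered_field) \<Rightarrow> ('v \<Rightarrow> 'k) \<Rightarrow> 'v \<Rightarrow> nat \<Rightarrow> 'k" where
  "ball_capacity V b m a n = capacity_on V b m (graph_ball V b n a) a"

text \<open>\<open>has_capacity V b m a c\<close>: the effective capacity at \<open>a\<close> exists and equals \<open>c\<close>.
  The junk value at index \<open>0\<close>, where the ball is empty, does not affect the limit.\<close>

definition has_capacity ::
  "'v set \<Rightarrow> ('v \<Rightarrow> 'v \<Rightarrow> 'k::linordered_field) \<Rightarrow> ('v \<Rightarrow> 'k) \<Rightarrow> 'v \<Rightarrow> 'k \<Rightarrow> bool" where
  "has_capacity V b m a c \<longleftrightarrow> converges_to (ball_capacity V b m a) c"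

end

theory Submission
  imports Defs
begin

text \<open>The capacity of \<open>a\<close> in a finite set \<open>K\<close> is the reciprocal of the diagonal value
  \<open>G\<^sub>K(a, a)\<close> of the Green function. For \<open>K \<subseteq> L\<close> the difference \<open>G\<^sub>L - G\<^sub>K\<close> is symmetric,
  nonnegative and harmonic on \<open>K\<close> in each variable, so applying the Harnack inequality along a path
  from \<open>a\<close> to \<open>x\<close> once in each variable bounds \<open>(G\<^sub>L - G\<^sub>K)(x, x)\<close> by a constant multiple of
  \<open>(G\<^sub>L - G\<^sub>K)(a, a)\<close>, with a constant not depending on \<open>K\<close> and \<open>L\<close>. The same inequality compares
  \<open>G\<^sub>K(x, x)\<close> with \<open>G\<^sub>K(a, a)\<close>. Hence the increments of the capacities at \<open>x\<close>
  are dominated by those at \<open>a\<close>, the Cauchy property passes from \<open>a\<close> to \<open>x\<close>, and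
  completeness gives the limit.\<close>

section \<open>The graph and its unnormalised Laplacian\<close>

locale infinite_network = weighted_graph V b m
  for V :: "'v set" and b :: "'v \<Rightarrow> 'v \<Rightarrow> 'k::linordered_field" and m :: "'v \<Rightarrow> 'k" +
  assumes infinite_V: "infinite V"
    and locally_finite: "locally_finite_graph V b"
    and connected: "connected_graph V b"
begin

definition nbrs :: "'v \<Rightarrow> 'v set" where
  "nbrs x = {y. adj V b x y}"

text \<open>The Laplacian without its factor \<open>1 / m x\<close>. Harmonicity is unchanged
  because \<open>m\<close> is positive on \<open>V\<close>, and in the capacity the factor
  \<open>m a\<close> cancels.\<close>

definition lap :: "('v \<Rightarrow> 'k) \<Rightarrow> 'v \<Rightarrow> 'k" where
  "lap f x = (\<Sum>y\<in>nbrs x. (f x - f y) * b x y)"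

definition deg :: "'v \<Rightarrow> 'k" where
  "deg x = (\<Sum>y\<in>nbrs x. b x y)"

lemma finite_nbrs: "x \<in> V \<Longrightarrow> finite (nbrs x)"
  using locally_finite by (simp add: nbrs_def locally_finite_graph_def)

lemma nbrs_subset: "nbrs x \<subseteq> V"
  by (auto simp: nbrs_def adj_def)

lemma b_pos: "x \<in> V \<Longrightarrow> y \<in> nbrs x \<Longrightarrow> 0 < b x y"
  using b_nonneg[of x y] by (auto simp: nbrs_def adj_def)

lemma laplacian_eq_lap: "x \<in> V \<Longrightarrow> laplacian V b m f x = lap f x / m x"
  by (simp add: laplacian_def lap_def nbrs_def)

lemma lap_cong:
  assumes "x \<in> V" "\<And>y. y \<in> V \<Longrightarrow> f y = g y"
  shows "lap f x = lap g x"
  unfolding lap_def using assms nbrs_subset[of x] by (intro sum.cong) auto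

lemma lap_diff: "lap (\<lambda>y. f y - g y) x = lap f x - lap g x"
  by (simp add: lap_def flip: sum_subtractf) (simp add: algebra_simps)

lemma lap_add_scale: "lap (\<lambda>y. f y + c * g y) x = lap f x + c * lap g x"
  by (simp add: lap_def sum_distrib_left flip: sum.distrib) (simp add: algebra_simps)

lemma lap_scale: "lap (\<lambda>y. c * g y) x = c * lap g x"
  using lap_add_scale[of "\<lambda>_. 0" c g x] by (simp add: lap_def)

lemma lap_eq_deg: "lap f x = f x * deg x - (\<Sum>y\<in>nbrs x. f y * b x y)"
  by (simp add: lap_def deg_def sum_distrib_left left_diff_distrib sum_subtractf)

subsection \<open>The Dirichlet problem\<close>

text \<open>A negative minimum over the finite set \<open>K\<close> would be the minimum over all of
  \<open>V\<close>. Superharmonicity passes it on to neighbours, so by connectedness it would reach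
  a vertex outside \<open>K\<close>, which exists since \<open>V\<close> is infinite; but there
  \<open>f\<close> is nonnegative.\<close>

lemma minimum_principle:
  assumes K: "finite K" "K \<subseteq> V"
    and sup: "\<And>x. x \<in> K \<Longrightarrow> 0 \<le> lap f x"
    and bd: "\<And>x. x \<in> V - K \<Longrightarrow> 0 \<le> f x"
    and x: "x \<in> V"
  shows "0 \<le> f x"
proof (rule ccontr)
  assume neg: "\<not> 0 \<le> f x"
  then have "x \<in> K" using bd x by auto
  define \<mu> where "\<mu> = Min (f ` K)"
  have "\<mu> \<le> f x" using K \<open>x \<in> K\<close> by (simp add: \<mu>_def)
  then have "\<mu> < 0" using neg by simp
  have min: "\<mu> \<le> f y" if "y \<in> V" for y
  proof (cases "y \<in> K")
    case True then show ?thesis using K by (simp add: \<mu>_def)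
  next
    case False then show ?thesis using bd[of y] \<open>\<mu> < 0\<close> that by simp
  qed
  have inK: "y \<in> K" if "y \<in> V" "f y = \<mu>" for y
    using bd[of y] \<open>\<mu> < 0\<close> that by (cases "y \<in> K") auto
  have "\<mu> \<in> f ` K" unfolding \<mu>_def using K \<open>x \<in> K\<close> by (intro Min_in) auto
  then obtain z where z: "z \<in> K" "f z = \<mu>" by auto
  \<comment> \<open>At a minimum all differences \<open>f w - f y\<close> are nonnegative, while
    their weighted sum over the neighbours is \<open>- lap f y\<close>, hence at most 0. So each of
    them vanishes.\<close>
  have step: "f y' = \<mu>" if "y \<in> V" "f y = \<mu>" "adj V b y y'" for y y'
  proof -
    have "y' \<in> nbrs y" using that by (simp add: nbrs_def)
    have nn: "0 \<le> (f w - f y) * b y w" if "w \<in> nbrs y" for w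
      using min[of w] nbrs_subset b_pos[OF \<open>y \<in> V\<close> that] that \<open>f y = \<mu>\<close>
      by (intro mult_nonneg_nonneg) auto
    have "(\<Sum>w\<in>nbrs y. (f w - f y) * b y w) = - lap f y"
      unfolding lap_def sum_negf[symmetric] by (intro sum.cong) (auto simp: algebra_simps)
    also have "\<dots> \<le> 0" using sup[OF inK] that by simp
    finally have "(\<Sum>w\<in>nbrs y. (f w - f y) * b y w) = 0"
      using sum_nonneg[of "nbrs y", OF nn] by (intro antisym)
    then have "(f y' - f y) * b y y' = 0"
      using nn \<open>y' \<in> nbrs y\<close> finite_nbrs[OF \<open>y \<in> V\<close>] by (simp add: sum_nonneg_eq_0_iff)
    then show ?thesis using b_pos[OF \<open>y \<in> V\<close> \<open>y' \<in> nbrs y\<close>] that by simp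
  qed
  have path: "(adj V b ^^ n) z y \<Longrightarrow> y \<in> V \<and> f y = \<mu>" for n y
  proof (induction n arbitrary: y)
    case 0 then show ?case using z K by auto
  next
    case (Suc n)
    then obtain w where w: "(adj V b ^^ n) z w" "adj V b w y" by auto
    then have "w \<in> V" "f w = \<mu>" using Suc.IH by simp_all
    then show ?case using step w(2) by (simp add: adj_def)
  qed
  have "\<not> V \<subseteq> K" using infinite_V K(1) finite_subset by auto
  then obtain w where w: "w \<in> V" "w \<notin> K" by blast
  obtain n where "(adj V b ^^ n) z w"
    using connected z K w unfolding connected_graph_def by blast
  then show False using path inK w by blast
qed

lemma comparison_principle:
  assumes "finite K" "K \<subseteq> V" "\<And>x. x \<in> K \<Longrightarrow> lap f x \<le> lap g x"
    "\<And>x. x \<in> V - K \<Longrightarrow> f x \<le> g x" "x \<in> V"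
  shows "f x \<le> g x"
  using minimum_principle[of K "\<lambda>y. g y - f y" x] assms by (simp add: lap_diff)

text \<open>Solve on \<open>K\<close> first, treating the new vertex \<open>z\<close> as boundary.
  Then add a multiple of \<open>e\<close>, the solution harmonic on \<open>K\<close> with boundary
  values 1 at \<open>z\<close> and 0 elsewhere. This changes only the value at \<open>z\<close> and
  values on \<open>K\<close>, preserves the equations on \<open>K\<close>, and can repair the
  equation at \<open>z\<close>.\<close>

lemma dirichlet_solvable:
  assumes "finite K" "K \<subseteq> V"
  shows "\<exists>u. (\<forall>x\<in>K. lap u x = f x) \<and> (\<forall>x\<in>V - K. u x = g x)"
  using assms
proof (induction K arbitrary: f g rule: finite_induct)
  case empty then show ?case by auto
next
  case (insert z K)
  then have K: "K \<subseteq> V" "z \<in> V" by auto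
  obtain u where u: "\<forall>x\<in>K. lap u x = f x" "\<forall>x\<in>V - K. u x = g x"
    using insert.IH[OF K(1)] by blast
  obtain e where e: "\<forall>x\<in>K. lap e x = 0" "\<forall>x\<in>V - K. e x = of_bool (x = z)"
    using insert.IH[OF K(1), of "\<lambda>_. 0" "\<lambda>x. of_bool (x = z)"] by blast
  \<comment> \<open>Otherwise \<open>e\<close> would be harmonic on \<open>insert z K\<close> with
    zero boundary values, and comparison with 0 would contradict \<open>e z = 1\<close>.\<close>
  have "lap e z \<noteq> 0"
  proof
    assume "lap e z = 0"
    moreover have "lap (\<lambda>_. 0) x = 0" for x by (simp add: lap_def)
    ultimately have "e z \<le> 0"
      using e insert.hyps insert.prems
      by (intro comparison_principle[of "insert z K" e "\<lambda>_. 0" z]) auto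
    then show False using e insert.hyps K by simp
  qed
  then have nonzero_div: "(f z - lap u z) / lap e z * lap e z = f z - lap u z" by simp
  show ?case
    using u e insert.hyps
    by (intro exI[of _ "\<lambda>y. u y + (f z - lap u z) / lap e z * e y"]) (auto simp: lap_add_scale nonzero_div simp del: times_divide_eq_left)
qed

subsection \<open>The Green function\<close>

text \<open>For \<open>z\<close> in \<open>K\<close>, the potential of a unit source at
  \<open>z\<close> with zero boundary values. The conditions say nothing about values off
  \<open>V\<close>, hence the choice operator.\<close>

definition green :: "'v set \<Rightarrow> 'v \<Rightarrow> 'v \<Rightarrow> 'k" where
  "green K z = (SOME u. (\<forall>x\<in>K. lap u x = of_bool (x = z)) \<and> (\<forall>x\<in>V - K. u x = 0))"

context
  fixes K :: "'v set"
  assumes finite_K: "finite K" and K_subset: "K \<subseteq> V"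
begin

lemma green_spec:
  "(\<forall>x\<in>K. lap (green K z) x = of_bool (x = z)) \<and> (\<forall>x\<in>V - K. green K z x = 0)"
  unfolding green_def
  by (rule someI_ex[OF dirichlet_solvable[OF finite_K K_subset]])

lemma lap_green: "x \<in> K \<Longrightarrow> lap (green K z) x = of_bool (x = z)"
  and green_outside: "x \<in> V - K \<Longrightarrow> green K z x = 0"
  using green_spec by blast+

lemma green_nonneg: "x \<in> V \<Longrightarrow> 0 \<le> green K z x"
  by (rule minimum_principle[OF finite_K K_subset]) (auto simp: lap_green green_outside)

text \<open>If the diagonal value were 0, only nonpositive terms would remain in the Laplacian at
  \<open>z\<close>, which has to be 1.\<close>

lemma green_diag_pos:
  assumes "z \<in> K"
  shows "0 < green K z z"
proof -
  have zV: "z \<in> V" using assms K_subset by auto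
  have "green K z z \<noteq> 0"
  proof
    assume "green K z z = 0"
    then have "lap (green K z) z = - (\<Sum>y\<in>nbrs z. green K z y * b z y)"
      by (simp add: lap_eq_deg)
    also have "\<dots> \<le> 0"
      using green_nonneg nbrs_subset b_pos[OF zV]
      by (auto intro!: sum_nonneg mult_nonneg_nonneg simp: less_imp_le subset_iff)
    finally show False using lap_green[OF assms, of z] by simp
  qed
  then show ?thesis using green_nonneg[OF zV, of z] by simp
qed

text \<open>On functions vanishing outside \<open>K\<close>, the operator \<open>lap\<close> acts on
  \<open>K\<close> as the matrix \<open>deg\<close> minus \<open>b\<close>, which is
  symmetric.\<close>

lemma greens_formula:
  assumes f: "\<And>x. x \<in> V - K \<Longrightarrow> f x = 0" and g: "\<And>x. x \<in> V - K \<Longrightarrow> g x = 0"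
  shows "(\<Sum>x\<in>K. lap f x * g x) = (\<Sum>x\<in>K. f x * lap g x)"
proof -
  have *: "lap h x = h x * deg x - (\<Sum>y\<in>K. h y * b x y)"
    if "x \<in> K" and h: "\<And>x. x \<in> V - K \<Longrightarrow> h x = 0" for h x
  proof -
    have "x \<in> V" using that K_subset by auto
    have "(\<Sum>y\<in>nbrs x. h y * b x y) = (\<Sum>y\<in>nbrs x \<inter> K. h y * b x y)"
      using h nbrs_subset[of x] finite_nbrs[OF \<open>x \<in> V\<close>]
      by (intro sum.mono_neutral_right) auto
    also have "\<dots> = (\<Sum>y\<in>K. h y * b x y)"
      using K_subset \<open>x \<in> V\<close> finite_K
      by (intro sum.mono_neutral_left) (auto simp: nbrs_def adj_def)
    finally show ?thesis by (simp add: lap_eq_deg)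
  qed
  have lap_f: "lap f x = f x * deg x - (\<Sum>y\<in>K. f y * b x y)" if "x \<in> K" for x
    using that f by (rule *)
  have lap_g: "lap g x = g x * deg x - (\<Sum>y\<in>K. g y * b x y)" if "x \<in> K" for x
    using that g by (rule *)
  have "(\<Sum>x\<in>K. lap f x * g x)
      = (\<Sum>x\<in>K. f x * g x * deg x) - (\<Sum>x\<in>K. \<Sum>y\<in>K. f y * g x * b x y)"
    unfolding sum_subtractf[symmetric]
    by (intro sum.cong) (simp_all add: lap_f sum_distrib_left right_diff_distrib mult_ac)
  also have "(\<Sum>x\<in>K. \<Sum>y\<in>K. f y * g x * b x y) = (\<Sum>y\<in>K. \<Sum>x\<in>K. f y * g x * b y x)"
    using K_subset by (subst sum.swap) (auto intro!: sum.cong simp: b_sym subset_iff)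
  also have "(\<Sum>x\<in>K. f x * g x * deg x) - \<dots> = (\<Sum>x\<in>K. f x * lap g x)"
    unfolding sum_subtractf[symmetric]
    by (intro sum.cong) (simp_all add: lap_g sum_distrib_left right_diff_distrib mult_ac)
  finally show ?thesis .
qed

text \<open>In Green's formula for \<open>green K x\<close> and \<open>green K y\<close> the
  Laplacians are indicators, so each sum collapses to a single term.\<close>

lemma green_sym:
  assumes "x \<in> K" "y \<in> K"
  shows "green K x y = green K y x"
proof -
  have "(\<Sum>w\<in>K. lap (green K x) w * green K y w) = (\<Sum>w\<in>K. green K x w * lap (green K y) w)"
    by (intro greens_formula green_outside)
  moreover have "(\<Sum>w\<in>K. lap (green K x) w * green K y w) = (\<Sum>w\<in>K. if w = x then green K y w else 0)"
    by (intro sum.cong) (auto simp: lap_green)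
  moreover have "(\<Sum>w\<in>K. green K x w * lap (green K y) w) = (\<Sum>w\<in>K. if w = y then green K x w else 0)"
    by (intro sum.cong) (auto simp: lap_green)
  ultimately show ?thesis using assms finite_K by simp
qed

text \<open>Dividing \<open>green K a\<close> by its value at \<open>a\<close> gives the capacity
  potential, whose \<open>lap\<close> at \<open>a\<close> is then the reciprocal of that
  value.\<close>

lemma capacity_on_eq_green:
  assumes a: "a \<in> K"
  shows "capacity_on V b m K a = 1 / green K a a"
proof -
  have aV: "a \<in> V" using a K_subset by auto
  define v where "v = restrict (\<lambda>x. 1 / green K a a * green K a x) V"
  have lap_v: "lap v x = 1 / green K a a * of_bool (x = a)" if "x \<in> K" for x
  proof -
    have "lap v x = lap (\<lambda>x. 1 / green K a a * green K a x) x"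
      using that K_subset by (intro lap_cong) (auto simp: v_def)
    then show ?thesis using that by (simp only: lap_scale lap_green)
  qed
  have "capacity_potential V b m K a = v"
    unfolding capacity_potential_def
  proof (rule the_equality)
    show "v \<in> extensional V \<and> (\<forall>x\<in>K - {a}. laplacian V b m v x = 0) \<and> v a = 1 \<and> (\<forall>x\<in>V - K. v x = 0)"
      using lap_v green_diag_pos[OF a] K_subset aV
      by (auto simp: v_def green_outside laplacian_eq_lap)
  next
    fix u
    assume u: "u \<in> extensional V \<and> (\<forall>x\<in>K - {a}. laplacian V b m u x = 0) \<and> u a = 1 \<and> (\<forall>x\<in>V - K. u x = 0)"
    have lap_u: "lap u x = 0" if "x \<in> K - {a}" for x
      using u that K_subset m_pos[of x] laplacian_eq_lap[of x u] by auto
    have va: "v a = 1" using green_diag_pos[OF a] aV by (simp add: v_def)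
    have out: "u x = v x" if "x \<in> V - (K - {a})" for x
      using that u va a green_outside[of x a] by (auto simp: v_def)
    show "u = v"
    proof (rule extensionalityI[of _ V])
      fix x assume x: "x \<in> V"
      \<comment> \<open>For uniqueness, \<open>a\<close> is counted as boundary: both functions are
        1 there and harmonic on \<open>K - {a}\<close>, so comparison applies in both
        directions.\<close>
      have fin: "finite (K - {a})" "K - {a} \<subseteq> V" using finite_K K_subset by auto
      have lap_eq: "lap u y = lap v y" if "y \<in> K - {a}" for y
        using lap_u[OF that] lap_v[of y] that by simp
      show "u x = v x"
        by (rule antisym; rule comparison_principle[OF fin _ _ x])
          (simp_all only: lap_eq out order_refl)
    qed (use u in \<open>auto simp: v_def\<close>)
  qed
  then show ?thesis
    using lap_v[OF a] m_pos[OF aV] by (simp add: capacity_on_def laplacian_eq_lap[OF aV])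
qed

end

text \<open>Both functions have the same Laplacian on \<open>K\<close>; outside \<open>K\<close> the
  first vanishes and the second is nonnegative.\<close>

lemma green_mono:
  assumes "finite L" "L \<subseteq> V" "K \<subseteq> L" "x \<in> V"
  shows "green K z x \<le> green L z x"
proof -
  have K: "finite K" "K \<subseteq> V" using assms finite_subset by auto
  show ?thesis
  proof (rule comparison_principle[OF K _ _ assms(4)])
    fix y assume y: "y \<in> K"
    then have "y \<in> L" using assms(3) by auto
    then show "lap (green K z) y \<le> lap (green L z) y"
      using y by (simp add: lap_green[OF K] lap_green[OF assms(1,2)])
  next
    fix y assume "y \<in> V - K"
    then show "green K z y \<le> green L z y"
      using green_outside[OF K] green_nonneg[OF assms(1,2)] by simp
  qed
qed

subsection \<open>The Harnack inequality\<close>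

text \<open>The finite set \<open>P\<close> consists of the vertices of a path from \<open>a\<close> to \<open>x\<close>, without \<open>x\<close>.\<close>

lemma harnack:
  assumes "a \<in> V" "x \<in> V"
  obtains C P where "0 < C" "finite P" "P \<subseteq> V"
    "\<forall>h. (\<forall>y\<in>V. 0 \<le> h y) \<longrightarrow> (\<forall>y\<in>P. 0 \<le> lap h y) \<longrightarrow> h x \<le> C * h a"
proof -
  obtain n where n: "(adj V b ^^ n) a x"
    using connected assms unfolding connected_graph_def by blast
  have "\<exists>C>0. \<exists>P. finite P \<and> P \<subseteq> V \<and>
      (\<forall>h. (\<forall>y\<in>V. 0 \<le> h y) \<longrightarrow> (\<forall>y\<in>P. 0 \<le> lap h y) \<longrightarrow> h x \<le> C * h a)"
    using n
  proof (induction n arbitrary: x)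
    case 0
    then show ?case by (intro exI[of _ 1] conjI exI[of _ "{}"]) auto
  next
    case (Suc n)
    then obtain y where y: "(adj V b ^^ n) a y" "adj V b y x" by auto
    obtain C P where CP: "0 < C" "finite P" "P \<subseteq> V"
      "\<forall>h. (\<forall>y\<in>V. 0 \<le> h y) \<longrightarrow> (\<forall>y\<in>P. 0 \<le> lap h y) \<longrightarrow> h y \<le> C * h a"
      using Suc.IH[OF y(1)] by (elim exE conjE)
    have yV: "y \<in> V" and x: "x \<in> nbrs y" using y by (auto simp: adj_def nbrs_def)
    have bp: "0 < b y x" using b_pos[OF yV x] .
    have "b y x \<le> deg y"
      unfolding deg_def using x finite_nbrs[OF yV] b_pos[OF yV]
      by (intro member_le_sum) (auto simp: less_imp_le)
    with bp have dp: "0 < deg y" by simp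
    \<comment> \<open>Superharmonicity at \<open>y\<close> bounds the neighbour sum by
      \<open>h y * deg y\<close>, and \<open>h x * b y x\<close> is one of its nonnegative terms.
      Each edge thus costs the factor \<open>deg y / b y x\<close>.\<close>
    have "h x \<le> deg y / b y x * C * h a"
      if h: "\<forall>y\<in>V. 0 \<le> h y" "\<forall>y\<in>insert y P. 0 \<le> lap h y" for h
    proof -
      have "h x * b y x \<le> (\<Sum>w\<in>nbrs y. h w * b y w)"
        using x finite_nbrs[OF yV] b_pos[OF yV] h(1) nbrs_subset
        by (intro member_le_sum[of x _ "\<lambda>w. h w * b y w"] mult_nonneg_nonneg)
          (auto simp: less_imp_le subset_iff)
      also have "\<dots> \<le> h y * deg y" using h(2) by (simp add: lap_eq_deg)
      also have "\<dots> \<le> C * h a * deg y" using CP(4) h dp by (intro mult_right_mono) simp_all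
      finally show ?thesis using bp by (simp add: field_simps)
    qed
    then show ?case
      using CP(1-3) bp dp yV
      by (intro exI[of _ "deg y / b y x * C"] conjI exI[of _ "insert y P"]) auto
  qed
  then obtain C P where "0 < C" "finite P" "P \<subseteq> V"
    "\<forall>h. (\<forall>y\<in>V. 0 \<le> h y) \<longrightarrow> (\<forall>y\<in>P. 0 \<le> lap h y) \<longrightarrow> h x \<le> C * h a"
    by (elim exE conjE)
  then show ?thesis by (rule that)
qed

text \<open>Stated for a general kernel because it serves both the Green function and its increment
  from \<open>K\<close> to \<open>L\<close>. Symmetry exchanges the variables between the two
  applications.\<close>

lemma harnack_twice:
  fixes H :: "'v \<Rightarrow> 'v \<Rightarrow> 'k"
  assumes C: "0 \<le> C" and V: "a \<in> V" "x \<in> V"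
    and harnack: "\<forall>h. (\<forall>y\<in>V. 0 \<le> h y) \<longrightarrow> (\<forall>y\<in>P. 0 \<le> lap h y)
      \<longrightarrow> h x \<le> C * h a"
    and nonneg: "\<And>z y. y \<in> V \<Longrightarrow> 0 \<le> H z y"
    and superharmonic: "\<And>z y. y \<in> P \<Longrightarrow> 0 \<le> lap (H z) y"
    and sym: "H a x = H x a"
  shows "H x x \<le> C\<^sup>2 * H a a"
proof -
  have "H x x \<le> C * H x a" using nonneg superharmonic harnack by simp
  also have "\<dots> = C * H a x" by (simp add: sym)
  also have "\<dots> \<le> C * (C * H a a)"
    using nonneg superharmonic harnack C by (intro mult_left_mono) simp_all
  finally show ?thesis by (simp add: power2_eq_square mult.assoc)
qed

section \<open>Comparing capacities at two vertices\<close>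

lemma capacity_on_pos:
  assumes "finite K" "K \<subseteq> V" "a \<in> K"
  shows "0 < capacity_on V b m K a"
  using green_diag_pos[OF assms] capacity_on_eq_green[OF assms] by simp

lemma capacity_on_antimono:
  assumes "finite L" "L \<subseteq> V" "K \<subseteq> L" "a \<in> K"
  shows "capacity_on V b m L a \<le> capacity_on V b m K a"
proof -
  have K: "finite K" "K \<subseteq> V" using assms finite_subset by auto
  have "green K a a \<le> green L a a" using assms by (intro green_mono) auto
  then show ?thesis
    using green_diag_pos[OF K assms(4)] assms(3,4)
    by (simp add: capacity_on_eq_green[OF K] capacity_on_eq_green[OF assms(1,2)] frac_le subset_iff)
qed

text \<open>\<open>M\<close> and \<open>P\<close> depend only on \<open>a\<close> and
  \<open>x\<close>, so the bounds are uniform along an exhaustion of \<open>V\<close>. The second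
  one turns a small decrease of the capacity at \<open>a\<close> into a small decrease at
  \<open>x\<close>.\<close>

lemma capacity_on_comparison:
  assumes a: "a \<in> V" and x: "x \<in> V"
  obtains M P where "0 < M" "finite P" "P \<subseteq> V"
    "\<And>K. finite K \<Longrightarrow> K \<subseteq> V \<Longrightarrow> P \<subseteq> K
      \<Longrightarrow> capacity_on V b m K x \<le> M * capacity_on V b m K a"
    "\<And>K L. finite L \<Longrightarrow> L \<subseteq> V \<Longrightarrow> K \<subseteq> L \<Longrightarrow> P \<subseteq> K
      \<Longrightarrow> capacity_on V b m K x - capacity_on V b m L x
        \<le> M * (capacity_on V b m K a - capacity_on V b m L a)"
proof -
  obtain C P where P: "0 < C" "finite P" "P \<subseteq> V" and
    harnack_ax: "\<forall>h. (\<forall>y\<in>V. 0 \<le> h y) \<longrightarrow> (\<forall>y\<in>P. 0 \<le> lap h y) \<longrightarrow> h x \<le> C * h a"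
    by (rule harnack[OF a x], rule that)
  obtain D Q where Q: "0 < D" "finite Q" "Q \<subseteq> V" and
    harnack_xa: "\<forall>h. (\<forall>y\<in>V. 0 \<le> h y) \<longrightarrow> (\<forall>y\<in>Q. 0 \<le> lap h y) \<longrightarrow> h a \<le> D * h x"
    by (rule harnack[OF x a], rule that)
  \<comment> \<open>\<open>P\<close> and \<open>Q\<close> make the Harnack inequalities applicable
    in both directions; \<open>a\<close> and \<open>x\<close> are included so that the symmetry and
    reciprocal formulas hold.\<close>
  define R where "R = insert a (insert x (P \<union> Q))"
  have R: "finite R" "R \<subseteq> V" "P \<subseteq> R" "Q \<subseteq> R" using P Q a x by (auto simp: R_def)
  \<comment> \<open>Harnack from \<open>x\<close> to \<open>a\<close>, so the roles of the two
    vertices are exchanged; taking reciprocals then bounds the capacity at \<open>x\<close> by that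
    at \<open>a\<close>.\<close>
  have green_le: "green K a a \<le> D\<^sup>2 * green K x x"
    if K: "finite K" "K \<subseteq> V" and RK: "R \<subseteq> K" for K
  proof (rule harnack_twice[where H = "green K" and P = Q and a = x and x = a])
    show "0 \<le> green K z y" if "y \<in> V" for z y using green_nonneg[OF K that] .
    show "0 \<le> lap (green K z) y" if "y \<in> Q" for z y
      using lap_green[OF K] that R RK by (auto simp: subset_iff)
    show "green K x a = green K a x" using RK by (intro green_sym K) (auto simp: R_def)
  qed (use Q a x harnack_xa in simp_all)
  have mem: "a \<in> K" "x \<in> K" if "R \<subseteq> K" for K using that by (auto simp: R_def)
  have cap_le: "capacity_on V b m K x \<le> D\<^sup>2 * capacity_on V b m K a"
    if K: "finite K" "K \<subseteq> V" and RK: "R \<subseteq> K" for K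
    using green_le[OF K RK] green_diag_pos[OF K] mem[OF RK]
    by (simp add: capacity_on_eq_green[OF K] field_simps)
  have diff_le: "capacity_on V b m K x - capacity_on V b m L x
      \<le> C\<^sup>2 * (D\<^sup>2 * D\<^sup>2) * (capacity_on V b m K a - capacity_on V b m L a)"
    if L: "finite L" "L \<subseteq> V" and KL: "K \<subseteq> L" and RK: "R \<subseteq> K" for K L
  proof -
    have K: "finite K" "K \<subseteq> V" using L KL finite_subset by auto
    have RL: "R \<subseteq> L" using KL RK by auto
    define H where "H z y = green L z y - green K z y" for z y
    have nonneg: "0 \<le> H z y" if "y \<in> V" for z y
      using green_mono[OF L KL that] by (simp add: H_def)
    have H_le: "H x x \<le> C\<^sup>2 * H a a"
    proof (rule harnack_twice[where H = H and P = P])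
      show "0 \<le> lap (H z) y" if "y \<in> P" for z y
      proof -
        have "y \<in> K" "y \<in> L" using that R RK RL by auto
        moreover have "H z = (\<lambda>y. green L z y - green K z y)" by (simp add: H_def fun_eq_iff)
        ultimately show ?thesis by (simp add: lap_diff lap_green[OF K] lap_green[OF L])
      qed
      show "H a x = H x a"
        using green_sym[OF K] green_sym[OF L] mem[OF RK] mem[OF RL] by (simp add: H_def)
    qed (use P a x nonneg harnack_ax in simp_all)
    \<comment> \<open>This is \<open>1/p - 1/q = (q - p) * (1/p) * (1/q)\<close> for the diagonal
      Green values. The first factor costs \<open>C\<^sup>2\<close>, each capacity factor
      \<open>D\<^sup>2\<close>.\<close>
    have cap_diff: "capacity_on V b m K z - capacity_on V b m L z
        = H z z * (capacity_on V b m K z * capacity_on V b m L z)" if "z \<in> K" for z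
      using green_diag_pos[OF K that] green_diag_pos[OF L, of z] that KL
      by (auto simp: capacity_on_eq_green[OF K] capacity_on_eq_green[OF L] H_def field_simps)
    have pos: "0 < capacity_on V b m K z" "0 < capacity_on V b m L z" if "z \<in> K" for z
      using that KL K L by (auto intro!: capacity_on_pos)
    have "H x x * (capacity_on V b m K x * capacity_on V b m L x)
        \<le> C\<^sup>2 * H a a * ((D\<^sup>2 * capacity_on V b m K a) * (D\<^sup>2 * capacity_on V b m L a))"
      using H_le cap_le[OF K RK] cap_le[OF L RL] pos mem[OF RK] nonneg a
      by (intro mult_mono mult_nonneg_nonneg) (simp_all add: less_imp_le)
    then show ?thesis using mem[OF RK] by (simp add: cap_diff mult_ac)
  qed
  define M where "M = max (D\<^sup>2) (C\<^sup>2 * (D\<^sup>2 * D\<^sup>2))"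
  show ?thesis
  proof (rule that[of M R])
    show "0 < M" using Q by (simp add: M_def less_max_iff_disj)
    show "capacity_on V b m K x \<le> M * capacity_on V b m K a"
      if K: "finite K" "K \<subseteq> V" and RK: "R \<subseteq> K" for K
    proof -
      have "D\<^sup>2 * capacity_on V b m K a \<le> M * capacity_on V b m K a"
        using capacity_on_pos[OF K] mem[OF RK] by (intro mult_right_mono) (auto simp: M_def less_imp_le)
      then show ?thesis using cap_le[OF K RK] by simp
    qed
    show "capacity_on V b m K x - capacity_on V b m L x
        \<le> M * (capacity_on V b m K a - capacity_on V b m L a)"
      if L: "finite L" "L \<subseteq> V" and KL: "K \<subseteq> L" and RK: "R \<subseteq> K" for K L
    proof -
      have "C\<^sup>2 * (D\<^sup>2 * D\<^sup>2) * (capacity_on V b m K a - capacity_on V b m L a)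
          \<le> M * (capacity_on V b m K a - capacity_on V b m L a)"
        using capacity_on_antimono[OF L KL] mem[OF RK]
        by (intro mult_right_mono) (auto simp: M_def)
      then show ?thesis using diff_le[OF L KL RK] by simp
    qed
  qed (use R in auto)
qed

subsection \<open>Balls\<close>

lemma adj_path_dist: "x \<in> V \<Longrightarrow> y \<in> V \<Longrightarrow> (adj V b ^^ graph_dist V b x y) x y"
  using connected unfolding graph_dist_def connected_graph_def by (metis LeastI_ex)

lemma graph_dist_le: "(adj V b ^^ n) x y \<Longrightarrow> graph_dist V b x y \<le> n"
  unfolding graph_dist_def by (rule Least_le)

lemma graph_dist_triangle:
  assumes "x \<in> V" "y \<in> V" "z \<in> V"
  shows "graph_dist V b x z \<le> graph_dist V b x y + graph_dist V b y z"
  using adj_path_dist assms by (intro graph_dist_le) (auto simp: relpowp_add)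

lemma graph_ball_subset: "graph_ball V b n a \<subseteq> V"
  by (auto simp: graph_ball_def)

lemma graph_ball_mono: "n \<le> k \<Longrightarrow> graph_ball V b n a \<subseteq> graph_ball V b k a"
  by (auto simp: graph_ball_def)

lemma graph_ball_shift:
  assumes "a \<in> V" "x \<in> V"
  shows "graph_ball V b n a \<subseteq> graph_ball V b (n + graph_dist V b x a) x"
  using graph_dist_triangle[OF assms(2,1)] by (fastforce simp: graph_ball_def)

text \<open>By local finiteness only finitely many vertices end a walk of \<open>k\<close> steps
  from \<open>a\<close>, and the ball is covered by these sets for \<open>k < n\<close>.\<close>

lemma finite_graph_ball:
  assumes "a \<in> V"
  shows "finite (graph_ball V b n a)"
proof -
  have "finite {y. (adj V b ^^ k) a y} \<and> {y. (adj V b ^^ k) a y} \<subseteq> V" for k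
  proof (induction k)
    case 0
    have "{y. a = y} = {a}" by auto
    then show ?case using assms by simp
  next
    case (Suc k)
    have "{y. (adj V b ^^ Suc k) a y} = (\<Union>z\<in>{z. (adj V b ^^ k) a z}. nbrs z)"
      by (auto simp: nbrs_def)
    then show ?case using Suc finite_nbrs nbrs_subset by (auto simp: subset_iff)
  qed
  moreover have "graph_ball V b n a \<subseteq> (\<Union>k<n. {y. (adj V b ^^ k) a y})"
    using adj_path_dist[OF assms] by (auto simp: graph_ball_def)
  ultimately show ?thesis by (auto intro: finite_subset)
qed

lemma finite_subset_graph_ball:
  assumes "finite P" "P \<subseteq> V"
  obtains N where "P \<subseteq> graph_ball V b N a"
proof
  \<comment> \<open>For empty \<open>P\<close> the value of \<open>Max\<close> is unspecified, but
    the inclusion is trivial.\<close>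
  show "P \<subseteq> graph_ball V b (Suc (Max (graph_dist V b a ` P))) a"
    using assms by (auto simp: graph_ball_def less_Suc_eq_le)
qed

lemma center_in_graph_ball: "a \<in> V \<Longrightarrow> 0 < n \<Longrightarrow> a \<in> graph_ball V b n a"
  using graph_dist_le[of 0 a a] by (auto simp: graph_ball_def)

text \<open>A ball around \<open>x\<close> lies between two balls around \<open>a\<close>, at the price of a shift \<open>d\<close> of
  the radius.\<close>

lemma ball_capacity_comparison:
  assumes a: "a \<in> V" and x: "x \<in> V"
  obtains M d N where "0 < M"
    "\<And>n. N \<le> n \<Longrightarrow> 0 \<le> ball_capacity V b m x n"
    "\<And>n. N \<le> n \<Longrightarrow> ball_capacity V b m x n \<le> M * ball_capacity V b m a (n - d)"
    "\<And>i j. N \<le> i \<Longrightarrow> i \<le> j \<Longrightarrow>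
      \<bar>ball_capacity V b m x i - ball_capacity V b m x j\<bar>
        \<le> M * (ball_capacity V b m a (i - d) - ball_capacity V b m a (j + d))"
proof -
  obtain M P where M: "0 < M" "finite P" "P \<subseteq> V"
    and cap_le: "\<And>K. finite K \<Longrightarrow> K \<subseteq> V \<Longrightarrow> P \<subseteq> K
      \<Longrightarrow> capacity_on V b m K x \<le> M * capacity_on V b m K a"
    and diff_le: "\<And>K L. finite L \<Longrightarrow> L \<subseteq> V \<Longrightarrow> K \<subseteq> L \<Longrightarrow> P \<subseteq> K
      \<Longrightarrow> capacity_on V b m K x - capacity_on V b m L x
        \<le> M * (capacity_on V b m K a - capacity_on V b m L a)"
    using capacity_on_comparison[OF a x] by metis
  obtain N where N: "P \<subseteq> graph_ball V b N x"
    using finite_subset_graph_ball[OF M(2,3)] .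
  let ?B = "graph_ball V b"
  \<comment> \<open>The inner inclusion uses the distance from \<open>x\<close> to \<open>a\<close>,
    the outer one that from \<open>a\<close> to \<open>x\<close>; the maximum covers both.\<close>
  define d where "d = max (graph_dist V b x a) (graph_dist V b a x)"
  \<comment> \<open>Exceeding \<open>d\<close> keeps \<open>n - d\<close> positive, so the
    subtraction is not truncated and the inner ball contains \<open>a\<close>.\<close>
  define N' where "N' = Suc (max N d)"
  have fin: "finite (?B n y)" "?B n y \<subseteq> V" if "y \<in> V" for n y
    using finite_graph_ball graph_ball_subset that by auto
  have P: "P \<subseteq> ?B n x" if "N' \<le> n" for n
  proof -
    have "N \<le> n" using that by (simp add: N'_def)
    then show ?thesis using N graph_ball_mono by blast
  qed
  have inner: "?B (n - d) a \<subseteq> ?B n x" if "N' \<le> n" for n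
  proof -
    have "?B (n - d) a \<subseteq> ?B (n - d + graph_dist V b x a) x" by (rule graph_ball_shift[OF a x])
    also have "\<dots> \<subseteq> ?B n x" using that by (intro graph_ball_mono) (auto simp: N'_def d_def)
    finally show ?thesis .
  qed
  have outer: "?B n x \<subseteq> ?B (n + d) a" for n
    using graph_ball_shift[OF x a, of n] graph_ball_mono[of "n + graph_dist V b a x" "n + d" a]
    by (auto simp: d_def)
  have a_inner: "a \<in> ?B (n - d) a" if "N' \<le> n" for n
    using that by (intro center_in_graph_ball a) (auto simp: N'_def)
  have x_in: "x \<in> ?B n x" if "N' \<le> n" for n
    using that by (intro center_in_graph_ball x) (auto simp: N'_def)
  \<comment> \<open>The pole stays at \<open>a\<close> while the ball around \<open>x\<close> is
    sandwiched; changing the pole to \<open>x\<close> is left to \<open>cap_le\<close> and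
    \<open>diff_le\<close>.\<close>
  have le_inner: "capacity_on V b m (?B n x) a \<le> ball_capacity V b m a (n - d)" if "N' \<le> n" for n
    unfolding ball_capacity_def
    by (rule capacity_on_antimono[OF fin[OF x] inner[OF that] a_inner[OF that]])
  have outer_le: "ball_capacity V b m a (n + d) \<le> capacity_on V b m (?B n x) a" if "N' \<le> n" for n
    unfolding ball_capacity_def
    by (rule capacity_on_antimono[OF fin[OF a] outer subsetD[OF inner[OF that] a_inner[OF that]]])
  show ?thesis
  proof (rule that[of M N' d])
    fix n assume n: "N' \<le> n"
    show "0 \<le> ball_capacity V b m x n"
      unfolding ball_capacity_def using capacity_on_pos[OF fin[OF x] x_in[OF n]] by (simp add: less_imp_le)
    have "ball_capacity V b m x n \<le> M * capacity_on V b m (?B n x) a"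
      unfolding ball_capacity_def by (intro cap_le fin x P n)
    also have "\<dots> \<le> M * ball_capacity V b m a (n - d)"
      using M by (intro mult_left_mono le_inner n) auto
    finally show "ball_capacity V b m x n \<le> M * ball_capacity V b m a (n - d)" .
  next
    fix i j :: nat assume i: "N' \<le> i" and ij: "i \<le> j"
    then have j: "N' \<le> j" by simp
    have sub: "?B i x \<subseteq> ?B j x" by (rule graph_ball_mono[OF ij])
    have "\<bar>ball_capacity V b m x i - ball_capacity V b m x j\<bar>
        = capacity_on V b m (?B i x) x - capacity_on V b m (?B j x) x"
      unfolding ball_capacity_def
      using capacity_on_antimono[OF fin[OF x] sub x_in[OF i]] by simp
    also have "\<dots> \<le> M * (capacity_on V b m (?B i x) a - capacity_on V b m (?B j x) a)"
      by (intro diff_le fin x sub P i)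
    also have "\<dots> \<le> M * (ball_capacity V b m a (i - d) - ball_capacity V b m a (j + d))"
      using M by (intro mult_left_mono diff_mono le_inner outer_le i j) auto
    finally show "\<bar>ball_capacity V b m x i - ball_capacity V b m x j\<bar>
        \<le> M * (ball_capacity V b m a (i - d) - ball_capacity V b m a (j + d))" .
  qed (use M in auto)
qed

section \<open>Transferring the limit from one vertex to another\<close>

lemma cauchy_seq_ball_capacity:
  assumes "a \<in> V" "x \<in> V" "has_capacity V b m a c"
  shows "cauchy_seq (ball_capacity V b m x)"
proof -
  obtain M d N where M: "0 < M" and le: "\<And>i j. N \<le> i \<Longrightarrow> i \<le> j \<Longrightarrow>
      \<bar>ball_capacity V b m x i - ball_capacity V b m x j\<bar>
        \<le> M * (ball_capacity V b m a (i - d) - ball_capacity V b m a (j + d))"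
    using ball_capacity_comparison[OF assms(1,2)] by metis
  show ?thesis
    unfolding cauchy_seq_def
  proof (intro allI impI)
    fix e :: 'k assume "0 < e"
    \<comment> \<open>Two errors of this size, multiplied by \<open>M\<close>, add up to
      \<open>e\<close>.\<close>
    then have "0 < e / (2 * M)" using M by simp
    then obtain N' where N': "\<And>n. N' \<le> n \<Longrightarrow> \<bar>ball_capacity V b m a n - c\<bar> \<le> e / (2 * M)"
      using assms(3) unfolding has_capacity_def converges_to_def by meson
    \<comment> \<open>The summand \<open>d\<close> ensures that the shifted index
      \<open>i - d\<close> is still at least \<open>N'\<close>.\<close>
    define N'' where "N'' = max N (N' + d)"
    have main: "\<bar>ball_capacity V b m x i - ball_capacity V b m x j\<bar> \<le> e"
      if "N'' \<le> i" "i \<le> j" for i j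
    proof -
      have "\<bar>ball_capacity V b m a (i - d) - c\<bar> \<le> e / (2 * M)"
        "\<bar>ball_capacity V b m a (j + d) - c\<bar> \<le> e / (2 * M)"
        using that by (auto simp: N''_def intro!: N')
      then have "ball_capacity V b m a (i - d) - ball_capacity V b m a (j + d)
          \<le> e / (2 * M) + e / (2 * M)" by linarith
      also have "\<dots> = e / M" using M by (simp add: field_simps)
      finally have "M * (ball_capacity V b m a (i - d) - ball_capacity V b m a (j + d)) \<le> e"
        using M by (simp add: field_simps)
      then show ?thesis using le[of i j] that by (simp add: N''_def)
    qed
    show "\<exists>N. \<forall>i\<ge>N. \<forall>j\<ge>N. \<bar>ball_capacity V b m x i - ball_capacity V b m x j\<bar> \<le> e"
    proof (intro exI allI impI)
      fix i j assume "N'' \<le> i" "N'' \<le> j"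
      then show "\<bar>ball_capacity V b m x i - ball_capacity V b m x j\<bar> \<le> e"
        using main[of i j] main[of j i] by (cases "i \<le> j") (auto simp: abs_minus_commute)
    qed
  qed
qed

text \<open>The capacities at \<open>x\<close> are squeezed between 0 and \<open>M\<close> times a
  shifted null sequence. This identifies the limit, which the Cauchy property alone does
  not.\<close>

lemma has_capacity_0_transfer:
  assumes "a \<in> V" "x \<in> V" "has_capacity V b m a 0"
  shows "has_capacity V b m x 0"
proof -
  obtain M d N where M: "0 < M"
    and nonneg: "\<And>n. N \<le> n \<Longrightarrow> 0 \<le> ball_capacity V b m x n"
    and le: "\<And>n. N \<le> n \<Longrightarrow> ball_capacity V b m x n \<le> M * ball_capacity V b m a (n - d)"
    using ball_capacity_comparison[OF assms(1,2)] by metis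
  show ?thesis
    unfolding has_capacity_def converges_to_def
  proof (intro allI impI)
    fix e :: 'k assume "0 < e"
    then have "0 < e / M" using M by simp
    then obtain N' where N': "\<And>n. N' \<le> n \<Longrightarrow> \<bar>ball_capacity V b m a n - 0\<bar> \<le> e / M"
      using assms(3) unfolding has_capacity_def converges_to_def by meson
    show "\<exists>N. \<forall>n\<ge>N. \<bar>ball_capacity V b m x n - 0\<bar> \<le> e"
    proof (intro exI allI impI)
      fix n assume n: "max N (N' + d) \<le> n"
      then have "N' \<le> n - d" by linarith
      then have "ball_capacity V b m a (n - d) \<le> e / M" using N' by (simp add: abs_le_iff)
      then have "M * ball_capacity V b m a (n - d) \<le> e" using M by (simp add: field_simps)
      then show "\<bar>ball_capacity V b m x n - 0\<bar> \<le> e" using le[of n] nonneg[of n] n by simp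
    qed
  qed
qed

end

theorem theorem2p9:
  fixes V :: "'v set" and b :: "'v \<Rightarrow> 'v \<Rightarrow> 'k::linordered_field" and m :: "'v \<Rightarrow> 'k"
  assumes "non_archimedean TYPE('k)"
    and "cauchy_complete TYPE('k)"
    and "countable_cofinality TYPE('k)"
    and "weighted_graph V b m"
    and "infinite V"
    and "locally_finite_graph V b"
    and "connected_graph V b"
  shows "((\<exists>a\<in>V. \<exists>c. has_capacity V b m a c) \<longrightarrow> (\<forall>x\<in>V. \<exists>c. has_capacity V b m x c)) \<and>
         ((\<exists>a\<in>V. has_capacity V b m a 0) \<longrightarrow> (\<forall>x\<in>V. has_capacity V b m x 0))"
proof -
  interpret infinite_network V b m
    using assms(4-7) by (simp add: infinite_network_def infinite_network_axioms_def)
  \<comment> \<open>Completeness supplies the limit at \<open>x\<close>, which may differ from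
    \<open>c\<close>.\<close>
  have "\<exists>c. has_capacity V b m x c" if "a \<in> V" "x \<in> V" "has_capacity V b m a c" for a x c
    using cauchy_seq_ball_capacity[OF that] assms(2)
    unfolding cauchy_complete_def has_capacity_def by blast
  then show ?thesis using has_capacity_0_transfer by blast
qed

end
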